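(* Let $R$ be a ring and let $M=M_1\oplus\cdots\oplus M_n$ be a right $R$-module which is a $D_2$ module. If $M_i$ is relatively d-CS-Rickart to $M_j$ for all $i,j\in\{1,\ldots,n\}$, then $M$ is a d-CS-Rickart module.
   Context: All rings are associative with nonzero identity; modules are unitary right modules. A module $M$ is a $D_2$ module if, whenever $A$ is a submodule of $M$ such that $M/A$ is isomorphic to a direct summand of $M$, then $A$ is a direct summand of $M$. A submodule $N$ of a module $M$ lies above a direct summand of $M$ if there is a decomposition $M=N_1\oplus N_2$ such that $N_1\subset N$ and $N_2\cap N$ is small in $N_2$ (a submodule $K$ of $L$ is small if $K+X=L$ implies $X=L$ for submodules $X$ of $L$). A module $M$ is relatively d-CS-Rickart to a module $N$ if for every $\varphi\in\mathrm{Hom}_R(M,N)$, $\mathrm{Im}\,\varphi$ lies above a direct summand of $N$. A module $M$ is d-CS-Rickart if for every $\varphi\in\mathrm{End}_R(M)$, $\mathrm{Im}\,\varphi$ lies above a direct summand of $M$. *)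

theory Defs
  imports "HOL-Algebra.Module" "HOL-Algebra.AbelCoset"
begin

text \<open>
  The locale \<open>module\<close> of HOL-Algebra requires a commutative ring, so unitary right modules over an
  arbitrary ring are introduced here on the same record type. The scalar action of the record is
  written on the left, but \<open>a \<odot>\<^bsub>M\<^esub> x\<close> stands for the right action \<open>x a\<close>; hence
  the shape of \<open>act_assoc\<close>, which is \<open>x (a b) = (x a) b\<close>. The fields \<open>mult\<close> and \<open>one\<close> of a module
  record carry no meaning. The library's \<open>submodule\<close> does not assume commutativity and is used
  as it is; a submodule \<open>H\<close> is turned into a module by \<open>M\<lparr>carrier := H\<rparr>\<close>.
\<close>

locale right_module = R?: ring R + M?: abelian_group M
  for R :: "('a, 'r) ring_scheme" (structure)
    and M :: "('a, 'b, 'm) module_scheme" (structure) +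
  assumes act_closed:
      "\<lbrakk>a \<in> carrier R; x \<in> carrier M\<rbrakk> \<Longrightarrow> a \<odot>\<^bsub>M\<^esub> x \<in> carrier M"
    and act_scalar_distr:
      "\<lbrakk>a \<in> carrier R; b \<in> carrier R; x \<in> carrier M\<rbrakk> \<Longrightarrow>
        (a \<oplus>\<^bsub>R\<^esub> b) \<odot>\<^bsub>M\<^esub> x = a \<odot>\<^bsub>M\<^esub> x \<oplus>\<^bsub>M\<^esub> b \<odot>\<^bsub>M\<^esub> x"
    and act_vector_distr:
      "\<lbrakk>a \<in> carrier R; x \<in> carrier M; y \<in> carrier M\<rbrakk> \<Longrightarrow>
        a \<odot>\<^bsub>M\<^esub> (x \<oplus>\<^bsub>M\<^esub> y) = a \<odot>\<^bsub>M\<^esub> x \<oplus>\<^bsub>M\<^esub> a \<odot>\<^bsub>M\<^esub> y"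
    and act_assoc:
      "\<lbrakk>a \<in> carrier R; b \<in> carrier R; x \<in> carrier M\<rbrakk> \<Longrightarrow>
        (a \<otimes>\<^bsub>R\<^esub> b) \<odot>\<^bsub>M\<^esub> x = b \<odot>\<^bsub>M\<^esub> (a \<odot>\<^bsub>M\<^esub> x)"
    and act_one:
      "x \<in> carrier M \<Longrightarrow> \<one>\<^bsub>R\<^esub> \<odot>\<^bsub>M\<^esub> x = x"

definition mod_hom ::
  "('a, 'r) ring_scheme \<Rightarrow> ('a, 'b, 'm) module_scheme \<Rightarrow> ('a, 'c, 'n) module_scheme \<Rightarrow> ('b \<Rightarrow> 'c) set"
  where "mod_hom R M N =
    {f \<in> hom (add_monoid M) (add_monoid N).
      \<forall>a \<in> carrier R. \<forall>x \<in> carrier M. f (a \<odot>\<^bsub>M\<^esub> x) = a \<odot>\<^bsub>N\<^esub> f x}"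

definition mod_iso ::
  "('a, 'r) ring_scheme \<Rightarrow> ('a, 'b, 'm) module_scheme \<Rightarrow> ('a, 'c, 'n) module_scheme \<Rightarrow> bool"
  where "mod_iso R M N \<longleftrightarrow> (\<exists>f \<in> mod_hom R M N. bij_betw f (carrier M) (carrier N))"

definition quot_mod :: "('a, 'b, 'm) module_scheme \<Rightarrow> 'b set \<Rightarrow> ('a, 'b set) module"
  where "quot_mod M A =
    \<lparr>carrier = a_rcosets\<^bsub>M\<^esub> A, mult = (\<lambda>_ _. undefined), one = undefined,
      zero = A, add = set_add M,
      smult = (\<lambda>a C. \<Union>x\<in>C. A +>\<^bsub>M\<^esub> (a \<odot>\<^bsub>M\<^esub> x))\<rparr>"

definition direct_decomp ::
  "('a, 'r) ring_scheme \<Rightarrow> ('a, 'b, 'm) module_scheme \<Rightarrow> 'b set \<Rightarrow> 'b set \<Rightarrow> bool"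
  where "direct_decomp R M A B \<longleftrightarrow>
    submodule A R M \<and> submodule B R M \<and> A <+>\<^bsub>M\<^esub> B = carrier M \<and> A \<inter> B = {\<zero>\<^bsub>M\<^esub>}"

definition direct_summand ::
  "('a, 'r) ring_scheme \<Rightarrow> ('a, 'b, 'm) module_scheme \<Rightarrow> 'b set \<Rightarrow> bool"
  where "direct_summand R M A \<longleftrightarrow> (\<exists>B. direct_decomp R M A B)"

text \<open>Internal direct sum: the canonical map from the product of the family to \<open>M\<close> is bijective.\<close>

definition internal_direct_sum ::
  "('a, 'r) ring_scheme \<Rightarrow> ('a, 'b, 'm) module_scheme \<Rightarrow> 'i set \<Rightarrow> ('i \<Rightarrow> 'b set) \<Rightarrow> bool"
  where "internal_direct_sum R M I N \<longleftrightarrow>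
    finite I \<and> (\<forall>i\<in>I. submodule (N i) R M) \<and>
    bij_betw (\<lambda>x. \<Oplus>\<^bsub>M\<^esub>i\<in>I. x i) (\<Pi>\<^sub>E i\<in>I. N i) (carrier M)"

definition small_submodule ::
  "('a, 'r) ring_scheme \<Rightarrow> ('a, 'b, 'm) module_scheme \<Rightarrow> 'b set \<Rightarrow> bool"
  where "small_submodule R L K \<longleftrightarrow>
    submodule K R L \<and>
    (\<forall>X. submodule X R L \<longrightarrow> K <+>\<^bsub>L\<^esub> X = carrier L \<longrightarrow> X = carrier L)"

definition lies_above_summand ::
  "('a, 'r) ring_scheme \<Rightarrow> ('a, 'b, 'm) module_scheme \<Rightarrow> 'b set \<Rightarrow> bool"
  where "lies_above_summand R M N \<longleftrightarrow>
    submodule N R M \<and>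
    (\<exists>N1 N2. direct_decomp R M N1 N2 \<and> N1 \<subseteq> N \<and>
      small_submodule R (M\<lparr>carrier := N2\<rparr>) (N2 \<inter> N))"

definition D2_module ::
  "('a, 'r) ring_scheme \<Rightarrow> ('a, 'b, 'm) module_scheme \<Rightarrow> bool"
  where "D2_module R M \<longleftrightarrow>
    (\<forall>A. submodule A R M \<longrightarrow>
      (\<exists>B. direct_summand R M B \<and> mod_iso R (quot_mod M A) (M\<lparr>carrier := B\<rparr>)) \<longrightarrow>
      direct_summand R M A)"

definition rel_d_CS_Rickart ::
  "('a, 'r) ring_scheme \<Rightarrow> ('a, 'b, 'm) module_scheme \<Rightarrow> ('a, 'c, 'n) module_scheme \<Rightarrow> bool"
  where "rel_d_CS_Rickart R M N \<longleftrightarrow>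
    (\<forall>\<phi> \<in> mod_hom R M N. lies_above_summand R N (\<phi> ` carrier M))"

definition d_CS_Rickart ::
  "('a, 'r) ring_scheme \<Rightarrow> ('a, 'b, 'm) module_scheme \<Rightarrow> bool"
  where "d_CS_Rickart R M \<longleftrightarrow>
    (\<forall>\<phi> \<in> mod_hom R M M. lies_above_summand R M (\<phi> ` carrier M))"

end

theory Submission
  imports Defs
begin

text \<open>
  A submodule \<open>X\<close> of \<open>M\<close> lies above a direct summand exactly when \<open>M\<close> has a decomposition \<open>A \<oplus> B\<close>
  with \<open>A \<subseteq> X\<close> and \<open>X \<inter> B\<close> small in \<open>M\<close> itself (\<open>lies_above_summand_iff\<close>): smallness does not change
  between \<open>M\<close> and a direct summand. So a summand can be split off repeatedly: if \<open>M = A \<oplus> B\<close> and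
  \<open>A \<subseteq> X\<close>, it suffices to treat \<open>X \<inter> B\<close> (\<open>lies_above_summand_extend\<close>). The proof removes summands
  from the image of an endomorphism in this way until a small submodule is left. Write \<open>p\<^sub>i\<close> for the
  projections of \<open>M\<close> onto the summands \<open>M\<^sub>i\<close>.

  Several sources, one target. Let the image of \<open>h\<close> lie in one \<open>M\<^sub>j\<close>. By hypothesis \<open>h(M\<^sub>i)\<close> contains a
  summand \<open>A\<close> of \<open>M = A \<oplus> B\<close> with \<open>h(M\<^sub>i) \<inter> B\<close> small. Let \<open>e\<close> be the projection onto \<open>A\<close> along \<open>B\<close>.
  Then \<open>h(M) \<inter> B\<close> is the image of \<open>h - e h\<close>, which has its image in \<open>M\<^sub>j\<close> as well and maps \<open>M\<^sub>i\<close> to a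
  small submodule. Once every \<open>M\<^sub>i\<close> has a small image, so has \<open>M\<close>.

  Several targets. For an arbitrary endomorphism \<open>f\<close>, the first part applies to \<open>p\<^sub>j f\<close> and gives
  \<open>M = A \<oplus> B\<close> with \<open>A \<subseteq> p\<^sub>j f(M)\<close> and \<open>p\<^sub>j f(M) \<inter> B\<close> small. With \<open>e\<close> as before, \<open>q = e p\<^sub>j\<close> is an
  idempotent with image \<open>A\<close>, and \<open>q f\<close> maps \<open>M\<close> onto \<open>A\<close>. Its kernel is a direct summand by D2, since
  the quotient by it is isomorphic to \<open>A\<close>. A complement of this kernel is
  carried by \<open>f\<close> onto a complement \<open>D \<subseteq> f(M)\<close> of the kernel of \<open>q\<close>, and \<open>f(M) \<inter> ker q\<close> is the
  image of \<open>f\<close> composed with the projection onto the kernel of \<open>q f\<close> (\<open>D2_split_image\<close>). This new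
  endomorphism has a small \<open>j\<close>-th component, and its image is contained in that of \<open>f\<close>, so the
  components that were small before remain small. Once all components are small, the image is small.
\<close>

section \<open>Submodules and endomorphisms\<close>

context right_module
begin

lemma smult_zero_scalar:
  assumes "x \<in> carrier M"
  shows "\<zero>\<^bsub>R\<^esub> \<odot>\<^bsub>M\<^esub> x = \<zero>\<^bsub>M\<^esub>"
proof -
  have "\<zero>\<^bsub>R\<^esub> \<odot>\<^bsub>M\<^esub> x \<oplus>\<^bsub>M\<^esub> \<zero>\<^bsub>R\<^esub> \<odot>\<^bsub>M\<^esub> x = \<zero>\<^bsub>R\<^esub> \<odot>\<^bsub>M\<^esub> x"
    using act_scalar_distr[of "\<zero>\<^bsub>R\<^esub>" "\<zero>\<^bsub>R\<^esub>" x] assms by simp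
  then show ?thesis
    using M.add.l_cancel_one'[of "\<zero>\<^bsub>R\<^esub> \<odot>\<^bsub>M\<^esub> x" "\<zero>\<^bsub>R\<^esub> \<odot>\<^bsub>M\<^esub> x"] assms act_closed
    by (metis M.add.r_cancel_one R.zero_closed)
qed

lemma smult_minus_one:
  assumes "x \<in> carrier M"
  shows "(\<ominus>\<^bsub>R\<^esub> \<one>\<^bsub>R\<^esub>) \<odot>\<^bsub>M\<^esub> x = \<ominus>\<^bsub>M\<^esub> x"
proof -
  have "(\<ominus>\<^bsub>R\<^esub> \<one>\<^bsub>R\<^esub>) \<odot>\<^bsub>M\<^esub> x \<oplus>\<^bsub>M\<^esub> x = \<zero>\<^bsub>M\<^esub>"
    using act_scalar_distr[of "\<ominus>\<^bsub>R\<^esub> \<one>\<^bsub>R\<^esub>" "\<one>\<^bsub>R\<^esub>" x] assms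
    by (simp add: R.l_neg smult_zero_scalar act_one)
  then show ?thesis
    using M.minus_equality assms act_closed by (metis R.a_inv_closed R.one_closed)
qed

lemma smult_zero_vector:
  assumes "a \<in> carrier R"
  shows "a \<odot>\<^bsub>M\<^esub> \<zero>\<^bsub>M\<^esub> = \<zero>\<^bsub>M\<^esub>"
  using act_vector_distr[of a "\<zero>\<^bsub>M\<^esub>" "\<zero>\<^bsub>M\<^esub>"] assms act_closed[of a "\<zero>\<^bsub>M\<^esub>"]
  by (metis M.add.r_cancel_one M.r_zero M.zero_closed)

text \<open>
  Closure under negatives is not among the conditions because \<open>- x\<close> is the scalar multiple of \<open>x\<close>
  by \<open>- 1\<close>.
\<close>

lemma submodule_criterion:
  assumes "H \<subseteq> carrier M" "\<zero>\<^bsub>M\<^esub> \<in> H"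
    and "\<And>x y. x \<in> H \<Longrightarrow> y \<in> H \<Longrightarrow> x \<oplus>\<^bsub>M\<^esub> y \<in> H"
    and smult: "\<And>a x. a \<in> carrier R \<Longrightarrow> x \<in> H \<Longrightarrow> a \<odot>\<^bsub>M\<^esub> x \<in> H"
  shows "submodule H R M"
proof -
  have "\<ominus>\<^bsub>M\<^esub> x \<in> H" if "x \<in> H" for x
    using smult[of "\<ominus>\<^bsub>R\<^esub> \<one>\<^bsub>R\<^esub>" x] that assms(1) smult_minus_one[of x] by auto
  then show ?thesis
    by (intro submodule.intro subgroup.intro submodule_axioms.intro)
      (use assms in \<open>auto simp: a_inv_def\<close>)
qed

lemma submodule_props:
  assumes "submodule H R M"
  shows submodule_subset: "H \<subseteq> carrier M"
    and submodule_zero: "\<zero>\<^bsub>M\<^esub> \<in> H"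
    and submodule_add: "\<And>x y. x \<in> H \<Longrightarrow> y \<in> H \<Longrightarrow> x \<oplus>\<^bsub>M\<^esub> y \<in> H"
    and submodule_minus: "\<And>x y. x \<in> H \<Longrightarrow> y \<in> H \<Longrightarrow> x \<ominus>\<^bsub>M\<^esub> y \<in> H"
    and submodule_smult: "\<And>a x. a \<in> carrier R \<Longrightarrow> x \<in> H \<Longrightarrow> a \<odot>\<^bsub>M\<^esub> x \<in> H"
    and submodule_subgroup: "subgroup H (add_monoid M)"
proof -
  interpret H: submodule H R M by fact
  show "H \<subseteq> carrier M" "\<zero>\<^bsub>M\<^esub> \<in> H" "subgroup H (add_monoid M)"
    using H.subset H.one_closed H.subgroup_axioms by auto
  show "x \<oplus>\<^bsub>M\<^esub> y \<in> H" if "x \<in> H" "y \<in> H" for x y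
    using H.m_closed that by simp
  show "x \<ominus>\<^bsub>M\<^esub> y \<in> H" if "x \<in> H" "y \<in> H" for x y
    using H.m_closed[of x] H.m_inv_closed[of y] that by (simp add: a_minus_def a_inv_def)
  show "a \<odot>\<^bsub>M\<^esub> x \<in> H" if "a \<in> carrier R" "x \<in> H" for a x
    using H.smult_closed that by simp
qed

lemma mem_submodule: "submodule H R M \<Longrightarrow> x \<in> H \<Longrightarrow> x \<in> carrier M"
  using submodule_subset by blast

lemma add_minus_cancel:
  assumes "x \<in> carrier M" "y \<in> carrier M"
  shows "y \<oplus>\<^bsub>M\<^esub> (x \<ominus>\<^bsub>M\<^esub> y) = x" "(x \<ominus>\<^bsub>M\<^esub> y) \<oplus>\<^bsub>M\<^esub> y = x" "(y \<oplus>\<^bsub>M\<^esub> x) \<ominus>\<^bsub>M\<^esub> y = x"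
    "(x \<oplus>\<^bsub>M\<^esub> y) \<ominus>\<^bsub>M\<^esub> y = x"
  using assms by (simp_all add: a_minus_def M.a_ac M.r_neg M.r_neg1 M.r_neg2)

lemma minus_self: "x \<in> carrier M \<Longrightarrow> x \<ominus>\<^bsub>M\<^esub> x = \<zero>\<^bsub>M\<^esub>"
  by (simp add: a_minus_def M.r_neg)

lemma minus_zero: "x \<in> carrier M \<Longrightarrow> x \<ominus>\<^bsub>M\<^esub> \<zero>\<^bsub>M\<^esub> = x"
  by (simp add: a_minus_def)

lemma smult_minus:
  assumes "a \<in> carrier R" "x \<in> carrier M" "y \<in> carrier M"
  shows "a \<odot>\<^bsub>M\<^esub> (x \<ominus>\<^bsub>M\<^esub> y) = a \<odot>\<^bsub>M\<^esub> x \<ominus>\<^bsub>M\<^esub> a \<odot>\<^bsub>M\<^esub> y"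
proof -
  have "a \<odot>\<^bsub>M\<^esub> (x \<ominus>\<^bsub>M\<^esub> y) \<oplus>\<^bsub>M\<^esub> a \<odot>\<^bsub>M\<^esub> y = a \<odot>\<^bsub>M\<^esub> x"
    using act_vector_distr[of a "x \<ominus>\<^bsub>M\<^esub> y" y] assms by (simp add: add_minus_cancel)
  then show ?thesis
    using add_minus_cancel(4)[of "a \<odot>\<^bsub>M\<^esub> (x \<ominus>\<^bsub>M\<^esub> y)" "a \<odot>\<^bsub>M\<^esub> y"] assms act_closed by simp
qed

lemma minus_add_distrib:
  assumes "x \<in> carrier M" "y \<in> carrier M" "u \<in> carrier M" "v \<in> carrier M"
  shows "(x \<oplus>\<^bsub>M\<^esub> y) \<ominus>\<^bsub>M\<^esub> (u \<oplus>\<^bsub>M\<^esub> v) = (x \<ominus>\<^bsub>M\<^esub> u) \<oplus>\<^bsub>M\<^esub> (y \<ominus>\<^bsub>M\<^esub> v)"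
  using assms by (simp add: a_minus_def M.minus_add M.a_ac)

lemma mem_set_add: "x \<in> A <+>\<^bsub>M\<^esub> B \<longleftrightarrow> (\<exists>a\<in>A. \<exists>b\<in>B. x = a \<oplus>\<^bsub>M\<^esub> b)"
  by (auto simp: set_add_def')

lemma set_addI: "a \<in> A \<Longrightarrow> b \<in> B \<Longrightarrow> a \<oplus>\<^bsub>M\<^esub> b \<in> A <+>\<^bsub>M\<^esub> B"
  by (auto simp: set_add_def')

lemma set_addE:
  assumes "x \<in> A <+>\<^bsub>M\<^esub> B"
  obtains a b where "a \<in> A" "b \<in> B" "x = a \<oplus>\<^bsub>M\<^esub> b"
  using assms by (auto simp: set_add_def')

lemma set_add_mono: "A \<subseteq> A' \<Longrightarrow> B \<subseteq> B' \<Longrightarrow> A <+>\<^bsub>M\<^esub> B \<subseteq> A' <+>\<^bsub>M\<^esub> B'"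
  by (auto simp: set_add_def')

lemma set_add_subset_submodule:
  assumes "submodule X R M" "A \<subseteq> X" "B \<subseteq> X"
  shows "A <+>\<^bsub>M\<^esub> B \<subseteq> X"
proof
  fix x assume "x \<in> A <+>\<^bsub>M\<^esub> B"
  then obtain a b where "a \<in> A" "b \<in> B" "x = a \<oplus>\<^bsub>M\<^esub> b" by (rule set_addE)
  then show "x \<in> X" using assms submodule_add[OF assms(1), of a b] by blast
qed

lemma set_add_restrict: "A <+>\<^bsub>M\<lparr>carrier := P\<rparr>\<^esub> B = A <+>\<^bsub>M\<^esub> B"
  by (auto simp: set_add_def')

lemma submodule_inter:
  "submodule A R M \<Longrightarrow> submodule B R M \<Longrightarrow> submodule (A \<inter> B) R M"
  by (rule submodule_criterion) (auto dest: submodule_props mem_submodule)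

lemma submodule_set_add:
  assumes A: "submodule A R M" and B: "submodule B R M"
  shows "submodule (A <+>\<^bsub>M\<^esub> B) R M" "A \<subseteq> A <+>\<^bsub>M\<^esub> B" "B \<subseteq> A <+>\<^bsub>M\<^esub> B"
proof -
  show "submodule (A <+>\<^bsub>M\<^esub> B) R M"
  proof (rule submodule_criterion)
    show "A <+>\<^bsub>M\<^esub> B \<subseteq> carrier M"
      using mem_submodule[OF A] mem_submodule[OF B] by (auto simp: mem_set_add)
    show "\<zero>\<^bsub>M\<^esub> \<in> A <+>\<^bsub>M\<^esub> B"
      using submodule_zero[OF A] submodule_zero[OF B]
      by (force simp: mem_set_add)
    show "x \<oplus>\<^bsub>M\<^esub> y \<in> A <+>\<^bsub>M\<^esub> B" if xy: "x \<in> A <+>\<^bsub>M\<^esub> B" "y \<in> A <+>\<^bsub>M\<^esub> B" for x y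
    proof -
      obtain a b c d where *: "a \<in> A" "b \<in> B" "c \<in> A" "d \<in> B" "x = a \<oplus>\<^bsub>M\<^esub> b" "y = c \<oplus>\<^bsub>M\<^esub> d"
        using xy by (auto simp: mem_set_add)
      then have "x \<oplus>\<^bsub>M\<^esub> y = (a \<oplus>\<^bsub>M\<^esub> c) \<oplus>\<^bsub>M\<^esub> (b \<oplus>\<^bsub>M\<^esub> d)"
        using mem_submodule[OF A] mem_submodule[OF B] by (simp add: M.a_ac)
      then show ?thesis
        using * submodule_add[OF A] submodule_add[OF B] by (metis set_addI)
    qed
    show "a \<odot>\<^bsub>M\<^esub> x \<in> A <+>\<^bsub>M\<^esub> B" if a: "a \<in> carrier R" and x: "x \<in> A <+>\<^bsub>M\<^esub> B" for a x
    proof -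
      obtain u v where *: "u \<in> A" "v \<in> B" "x = u \<oplus>\<^bsub>M\<^esub> v"
        using x by (rule set_addE)
      then have "a \<odot>\<^bsub>M\<^esub> x = a \<odot>\<^bsub>M\<^esub> u \<oplus>\<^bsub>M\<^esub> a \<odot>\<^bsub>M\<^esub> v"
        using a act_vector_distr mem_submodule[OF A] mem_submodule[OF B] by simp
      then show ?thesis
        using * a submodule_smult[OF A] submodule_smult[OF B] by (metis set_addI)
    qed
  qed
  show "A \<subseteq> A <+>\<^bsub>M\<^esub> B"
    using submodule_zero[OF B] mem_submodule[OF A] by (force simp: mem_set_add)
  show "B \<subseteq> A <+>\<^bsub>M\<^esub> B"
    using submodule_zero[OF A] mem_submodule[OF B] by (force simp: mem_set_add)
qed

text \<open>
  Submodules of a submodule, and their smallness, can thus be discussed inside \<open>M\<close>.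
\<close>

lemma submodule_restrict_iff:
  assumes P: "submodule P R M"
  shows "submodule H R (M\<lparr>carrier := P\<rparr>) \<longleftrightarrow> submodule H R M \<and> H \<subseteq> P"
proof
  assume "submodule H R (M\<lparr>carrier := P\<rparr>)"
  then interpret H: submodule H R "M\<lparr>carrier := P\<rparr>" .
  have "H \<subseteq> P" using H.subset by simp
  moreover have "submodule H R M"
  proof (rule submodule_criterion)
    show "H \<subseteq> carrier M" using \<open>H \<subseteq> P\<close> submodule_subset[OF P] by blast
    show "\<zero>\<^bsub>M\<^esub> \<in> H" using H.one_closed by simp
    show "x \<oplus>\<^bsub>M\<^esub> y \<in> H" if "x \<in> H" "y \<in> H" for x y using H.m_closed that by simp
    show "a \<odot>\<^bsub>M\<^esub> x \<in> H" if "a \<in> carrier R" "x \<in> H" for a x using H.smult_closed that by simp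
  qed
  ultimately show "submodule H R M \<and> H \<subseteq> P" by simp
next
  assume H: "submodule H R M \<and> H \<subseteq> P"
  then have "subgroup H (add_monoid M\<lparr>carrier := P\<rparr>)"
    using M.add.subgroup_incl submodule_subgroup P by blast
  moreover have "add_monoid M\<lparr>carrier := P\<rparr> = add_monoid (M\<lparr>carrier := P\<rparr>)" by simp
  ultimately show "submodule H R (M\<lparr>carrier := P\<rparr>)"
    using H submodule_smult by (auto intro!: submodule.intro submodule_axioms.intro)
qed

lemma endI:
  assumes "\<And>x. x \<in> carrier M \<Longrightarrow> f x \<in> carrier M"
    and "\<And>x y. x \<in> carrier M \<Longrightarrow> y \<in> carrier M \<Longrightarrow> f (x \<oplus>\<^bsub>M\<^esub> y) = f x \<oplus>\<^bsub>M\<^esub> f y"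
    and "\<And>a x. a \<in> carrier R \<Longrightarrow> x \<in> carrier M \<Longrightarrow> f (a \<odot>\<^bsub>M\<^esub> x) = a \<odot>\<^bsub>M\<^esub> f x"
  shows "f \<in> mod_hom R M M"
  using assms by (auto simp: mod_hom_def hom_def)

lemma end_props:
  assumes "f \<in> mod_hom R M M"
  shows end_closed: "\<And>x. x \<in> carrier M \<Longrightarrow> f x \<in> carrier M"
    and end_add: "\<And>x y. x \<in> carrier M \<Longrightarrow> y \<in> carrier M \<Longrightarrow> f (x \<oplus>\<^bsub>M\<^esub> y) = f x \<oplus>\<^bsub>M\<^esub> f y"
    and end_smult: "\<And>a x. a \<in> carrier R \<Longrightarrow> x \<in> carrier M \<Longrightarrow> f (a \<odot>\<^bsub>M\<^esub> x) = a \<odot>\<^bsub>M\<^esub> f x"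
    and end_zero: "f \<zero>\<^bsub>M\<^esub> = \<zero>\<^bsub>M\<^esub>"
    and end_minus: "\<And>x y. x \<in> carrier M \<Longrightarrow> y \<in> carrier M \<Longrightarrow> f (x \<ominus>\<^bsub>M\<^esub> y) = f x \<ominus>\<^bsub>M\<^esub> f y"
proof -
  show closed: "f x \<in> carrier M" if "x \<in> carrier M" for x
    using assms that by (auto simp: mod_hom_def hom_def)
  show add: "f (x \<oplus>\<^bsub>M\<^esub> y) = f x \<oplus>\<^bsub>M\<^esub> f y" if "x \<in> carrier M" "y \<in> carrier M" for x y
    using assms that by (auto simp: mod_hom_def hom_def)
  show "f (a \<odot>\<^bsub>M\<^esub> x) = a \<odot>\<^bsub>M\<^esub> f x" if "a \<in> carrier R" "x \<in> carrier M" for a x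
    using assms that by (auto simp: mod_hom_def hom_def)
  show "f \<zero>\<^bsub>M\<^esub> = \<zero>\<^bsub>M\<^esub>"
    using add[of "\<zero>\<^bsub>M\<^esub>" "\<zero>\<^bsub>M\<^esub>"] closed[of "\<zero>\<^bsub>M\<^esub>"]
    by (metis M.add.r_cancel_one M.r_zero M.zero_closed)
  show "f (x \<ominus>\<^bsub>M\<^esub> y) = f x \<ominus>\<^bsub>M\<^esub> f y" if "x \<in> carrier M" "y \<in> carrier M" for x y
    using add[of "x \<ominus>\<^bsub>M\<^esub> y" y] add_minus_cancel(4)[of "f (x \<ominus>\<^bsub>M\<^esub> y)" "f y"] that
    by (simp add: add_minus_cancel closed)
qed

lemma end_comp:
  "f \<in> mod_hom R M M \<Longrightarrow> g \<in> mod_hom R M M \<Longrightarrow> (\<lambda>x. f (g x)) \<in> mod_hom R M M"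
  by (rule endI) (simp_all add: end_props)

lemma end_complement:
  "e \<in> mod_hom R M M \<Longrightarrow> (\<lambda>x. x \<ominus>\<^bsub>M\<^esub> e x) \<in> mod_hom R M M"
  by (rule endI) (simp_all add: end_props minus_add_distrib smult_minus)

lemma end_image_submodule:
  assumes f: "f \<in> mod_hom R M M" and A: "submodule A R M"
  shows "submodule (f ` A) R M"
proof (rule submodule_criterion)
  show "f ` A \<subseteq> carrier M" using end_closed[OF f] mem_submodule[OF A] by blast
  show "\<zero>\<^bsub>M\<^esub> \<in> f ` A" using end_zero[OF f] submodule_zero[OF A] by (metis imageI)
  show "x \<oplus>\<^bsub>M\<^esub> y \<in> f ` A" if "x \<in> f ` A" "y \<in> f ` A" for x y
    using that end_add[OF f] submodule_add[OF A] mem_submodule[OF A]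
    by (smt (verit) image_iff)
  show "a \<odot>\<^bsub>M\<^esub> x \<in> f ` A" if "a \<in> carrier R" "x \<in> f ` A" for a x
    using that end_smult[OF f] submodule_smult[OF A] mem_submodule[OF A]
    by (smt (verit) image_iff)
qed

lemma end_vimage_submodule:
  assumes f: "f \<in> mod_hom R M M" and A: "submodule A R M"
  shows "submodule {x \<in> carrier M. f x \<in> A} R M"
  by (rule submodule_criterion)
    (use end_props[OF f] submodule_props[OF A] act_closed in auto)

lemma submodule_carrier: "submodule (carrier M) R M"
  by (rule submodule_criterion) (simp_all add: act_closed)

lemma submodule_zero_set: "submodule {\<zero>\<^bsub>M\<^esub>} R M"
  by (rule submodule_criterion) (simp_all add: smult_zero_vector)

lemma end_kernel_submodule:
  "f \<in> mod_hom R M M \<Longrightarrow> submodule {x \<in> carrier M. f x = \<zero>\<^bsub>M\<^esub>} R M"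
  using end_vimage_submodule[OF _ submodule_zero_set] by simp

section \<open>Direct decompositions and their projections\<close>

lemma direct_decomp_projection:
  assumes "direct_decomp R M A B"
  obtains e where "e \<in> mod_hom R M M" "\<And>x. x \<in> carrier M \<Longrightarrow> e x \<in> A"
    "\<And>x. x \<in> A \<Longrightarrow> e x = x" "{x \<in> carrier M. e x = \<zero>\<^bsub>M\<^esub>} = B"
proof -
  have A: "submodule A R M" and B: "submodule B R M"
    and sum: "A <+>\<^bsub>M\<^esub> B = carrier M" and int: "A \<inter> B = {\<zero>\<^bsub>M\<^esub>}"
    using assms by (auto simp: direct_decomp_def)
  note mem = mem_submodule[OF A] mem_submodule[OF B]
  define e where "e x = (SOME a. a \<in> A \<and> x \<ominus>\<^bsub>M\<^esub> a \<in> B)" for x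
  have e: "e x \<in> A \<and> x \<ominus>\<^bsub>M\<^esub> e x \<in> B" if x: "x \<in> carrier M" for x
  proof -
    obtain a b where "a \<in> A" "b \<in> B" "x = a \<oplus>\<^bsub>M\<^esub> b"
      using x unfolding sum[symmetric] by (rule set_addE)
    then have "a \<in> A \<and> x \<ominus>\<^bsub>M\<^esub> a \<in> B" using mem by (simp add: add_minus_cancel)
    then show ?thesis unfolding e_def by (rule someI)
  qed
  have uniq: "e (a \<oplus>\<^bsub>M\<^esub> b) = a" if ab: "a \<in> A" "b \<in> B" for a b
  proof -
    let ?x = "a \<oplus>\<^bsub>M\<^esub> b"
    have x: "?x \<in> carrier M" using ab mem by simp
    have eM: "e ?x \<in> carrier M" using e[OF x] mem by blast
    (* two decompositions of the same element differ by an element of A \<inter> B *)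
    have "a \<ominus>\<^bsub>M\<^esub> e ?x = (?x \<ominus>\<^bsub>M\<^esub> e ?x) \<ominus>\<^bsub>M\<^esub> b"
      using ab mem x eM M.r_neg2[of b "\<ominus>\<^bsub>M\<^esub> e ?x"] by (simp add: a_minus_def M.a_ac)
    moreover have "a \<ominus>\<^bsub>M\<^esub> e ?x \<in> A"
      using e[OF x] ab submodule_minus[OF A] by blast
    moreover have "(?x \<ominus>\<^bsub>M\<^esub> e ?x) \<ominus>\<^bsub>M\<^esub> b \<in> B"
      using e[OF x] ab submodule_minus[OF B] by blast
    ultimately have "a \<ominus>\<^bsub>M\<^esub> e ?x = \<zero>\<^bsub>M\<^esub>" using int by auto
    then show ?thesis
      using add_minus_cancel(2)[of a "e ?x"] e[OF x] ab mem by simp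
  qed
  have dec: "\<exists>a\<in>A. \<exists>b\<in>B. x = a \<oplus>\<^bsub>M\<^esub> b" if "x \<in> carrier M" for x
    using that unfolding sum[symmetric] mem_set_add .
  show thesis
  proof
    show "e \<in> mod_hom R M M"
    proof (rule endI)
      show "e x \<in> carrier M" if "x \<in> carrier M" for x using e[OF that] mem by blast
      show "e (x \<oplus>\<^bsub>M\<^esub> y) = e x \<oplus>\<^bsub>M\<^esub> e y" if xy: "x \<in> carrier M" "y \<in> carrier M" for x y
      proof -
        obtain a b c d where *: "a \<in> A" "b \<in> B" "c \<in> A" "d \<in> B" "x = a \<oplus>\<^bsub>M\<^esub> b" "y = c \<oplus>\<^bsub>M\<^esub> d"
          using dec[OF xy(1)] dec[OF xy(2)] by blast
        then have "x \<oplus>\<^bsub>M\<^esub> y = (a \<oplus>\<^bsub>M\<^esub> c) \<oplus>\<^bsub>M\<^esub> (b \<oplus>\<^bsub>M\<^esub> d)"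
          using mem by (simp add: M.a_ac)
        then show ?thesis
          using * uniq submodule_add[OF A] submodule_add[OF B] by simp
      qed
      show "e (r \<odot>\<^bsub>M\<^esub> x) = r \<odot>\<^bsub>M\<^esub> e x" if r: "r \<in> carrier R" and x: "x \<in> carrier M" for r x
      proof -
        obtain a b where *: "a \<in> A" "b \<in> B" "x = a \<oplus>\<^bsub>M\<^esub> b"
          using dec[OF x] by blast
        then have "r \<odot>\<^bsub>M\<^esub> x = r \<odot>\<^bsub>M\<^esub> a \<oplus>\<^bsub>M\<^esub> r \<odot>\<^bsub>M\<^esub> b"
          using mem r act_vector_distr by simp
        then show ?thesis
          using * r uniq submodule_smult[OF A] submodule_smult[OF B] by simp
      qed
    qed
    show "e x \<in> A" if "x \<in> carrier M" for x using e[OF that] by blast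
    show "e x = x" if "x \<in> A" for x
      using uniq[OF that submodule_zero[OF B]] mem that by simp
    show "{x \<in> carrier M. e x = \<zero>\<^bsub>M\<^esub>} = B"
    proof safe
      fix x assume x: "x \<in> carrier M" "e x = \<zero>\<^bsub>M\<^esub>"
      then show "x \<in> B" using e[OF x(1)] by (simp add: minus_zero)
    next
      fix x assume x: "x \<in> B"
      then show "x \<in> carrier M" using mem by blast
      then show "e x = \<zero>\<^bsub>M\<^esub>" using uniq[OF submodule_zero[OF A] x] by simp
    qed
  qed
qed

section \<open>Small submodules\<close>

lemma small_mono:
  assumes "small_submodule R M S" "submodule T R M" "T \<subseteq> S"
  shows "small_submodule R M T"
proof -
  have S: "submodule S R M" using assms by (simp add: small_submodule_def)
  have "S <+>\<^bsub>M\<^esub> X = carrier M" if X: "submodule X R M" "T <+>\<^bsub>M\<^esub> X = carrier M" for X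
  proof
    show "S <+>\<^bsub>M\<^esub> X \<subseteq> carrier M" using submodule_subset submodule_set_add S X by blast
    show "carrier M \<subseteq> S <+>\<^bsub>M\<^esub> X"
      using set_add_mono[OF assms(3), of X X] X(2) by simp
  qed
  then show ?thesis using assms by (simp add: small_submodule_def)
qed

lemma small_zero: "small_submodule R M {\<zero>\<^bsub>M\<^esub>}"
proof -
  have "X = carrier M" if X: "submodule X R M" and "{\<zero>\<^bsub>M\<^esub>} <+>\<^bsub>M\<^esub> X = carrier M" for X
    using that(2) mem_submodule[OF X] by (auto simp: set_eq_iff mem_set_add)
  then show ?thesis by (simp add: small_submodule_def submodule_zero_set)
qed

lemma small_add:
  assumes "small_submodule R M S" "small_submodule R M T"
  shows "small_submodule R M (S <+>\<^bsub>M\<^esub> T)"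
proof -
  have S: "submodule S R M" and T: "submodule T R M"
    using assms by (simp_all add: small_submodule_def)
  have "X = carrier M" if X: "submodule X R M" "(S <+>\<^bsub>M\<^esub> T) <+>\<^bsub>M\<^esub> X = carrier M" for X
  proof -
    have "S <+>\<^bsub>M\<^esub> (T <+>\<^bsub>M\<^esub> X) = carrier M"
      using X(2) M.add.set_mult_assoc[of S T X] submodule_subset S T X(1)
      by (simp add: set_add_def)
    then show ?thesis
      using assms X(1) submodule_set_add(1)[OF T X(1)] by (simp add: small_submodule_def)
  qed
  then show ?thesis using submodule_set_add(1)[OF S T] by (simp add: small_submodule_def)
qed

text \<open>
  If \<open>f(S) + X = M\<close>, then the preimage \<open>Y\<close> of \<open>X\<close> satisfies \<open>S + Y = M\<close>, hence \<open>Y = M\<close>. So the whole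
  image of \<open>f\<close>, and with it \<open>f(S)\<close>, lies in \<open>X\<close>.
\<close>

lemma small_image:
  assumes small: "small_submodule R M S" and f: "f \<in> mod_hom R M M"
  shows "small_submodule R M (f ` S)"
proof -
  have S: "submodule S R M" using small by (simp add: small_submodule_def)
  have "X = carrier M" if X: "submodule X R M" "f ` S <+>\<^bsub>M\<^esub> X = carrier M" for X
  proof -
    let ?Y = "{x \<in> carrier M. f x \<in> X}"
    have Y: "submodule ?Y R M" by (rule end_vimage_submodule[OF f X(1)])
    have "S <+>\<^bsub>M\<^esub> ?Y = carrier M"
    proof
      show "S <+>\<^bsub>M\<^esub> ?Y \<subseteq> carrier M"
        using submodule_subset submodule_set_add(1)[OF S Y] by blast
      show "carrier M \<subseteq> S <+>\<^bsub>M\<^esub> ?Y"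
      proof
        fix m assume m: "m \<in> carrier M"
        then have "f m \<in> f ` S <+>\<^bsub>M\<^esub> X" using X end_closed[OF f] by simp
        then obtain s x where sx: "s \<in> S" "x \<in> X" "f m = f s \<oplus>\<^bsub>M\<^esub> x"
          by (auto simp: mem_set_add)
        have s: "s \<in> carrier M" using sx mem_submodule[OF S] by blast
        have "f (m \<ominus>\<^bsub>M\<^esub> s) = x"
          using sx s m mem_submodule[OF X(1)] end_props[OF f] by (simp add: add_minus_cancel)
        then have "m \<ominus>\<^bsub>M\<^esub> s \<in> ?Y" using sx s m by simp
        moreover have "m = s \<oplus>\<^bsub>M\<^esub> (m \<ominus>\<^bsub>M\<^esub> s)" using s m by (simp add: add_minus_cancel)
        ultimately show "m \<in> S <+>\<^bsub>M\<^esub> ?Y" using sx(1) unfolding mem_set_add by blast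
      qed
    qed
    then have "?Y = carrier M" using small Y by (simp add: small_submodule_def)
    then have fS: "f ` S \<subseteq> X" using mem_submodule[OF S] by blast
    show ?thesis
    proof
      show "X \<subseteq> carrier M" using submodule_subset X by blast
      show "carrier M \<subseteq> X"
        using set_add_subset_submodule[OF X(1) fS subset_refl] X(2) by simp
    qed
  qed
  then show ?thesis using end_image_submodule[OF f S] by (simp add: small_submodule_def)
qed

text \<open>
  By the modular law, \<open>S + X = M\<close> with \<open>S \<subseteq> P\<close> implies \<open>S + (X \<inter> P) = P\<close>. Smallness in \<open>P\<close> then gives
  \<open>S \<subseteq> P \<subseteq> X\<close>.
\<close>

lemma small_in_submodule_imp_small:
  assumes P: "submodule P R M" and small: "small_submodule R (M\<lparr>carrier := P\<rparr>) S"
  shows "small_submodule R M S"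
proof -
  have S: "submodule S R M" "S \<subseteq> P"
    using small by (simp_all add: small_submodule_def submodule_restrict_iff[OF P])
  have "X = carrier M" if X: "submodule X R M" "S <+>\<^bsub>M\<^esub> X = carrier M" for X
  proof -
    have "S <+>\<^bsub>M\<^esub> (X \<inter> P) = P"
    proof
      show "S <+>\<^bsub>M\<^esub> (X \<inter> P) \<subseteq> P"
        using set_add_subset_submodule[OF P] S by simp
      show "P \<subseteq> S <+>\<^bsub>M\<^esub> (X \<inter> P)"
      proof
        fix p assume p: "p \<in> P"
        then have "p \<in> S <+>\<^bsub>M\<^esub> X" using X mem_submodule[OF P] by simp
        then obtain s x where sx: "s \<in> S" "x \<in> X" "p = s \<oplus>\<^bsub>M\<^esub> x" by (auto simp: mem_set_add)
        then have "x = p \<ominus>\<^bsub>M\<^esub> s"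
          using mem_submodule[OF S(1)] mem_submodule[OF X(1)] by (simp add: add_minus_cancel)
        then have "x \<in> P" using p sx S submodule_minus[OF P] by blast
        then show "p \<in> S <+>\<^bsub>M\<^esub> (X \<inter> P)" using sx by (auto simp: mem_set_add)
      qed
    qed
    moreover have "submodule (X \<inter> P) R M" by (rule submodule_inter[OF X(1) P])
    ultimately have "X \<inter> P = P"
      using small by (simp add: small_submodule_def submodule_restrict_iff[OF P] set_add_restrict)
    then have SX: "S \<subseteq> X" using S by blast
    show ?thesis
    proof
      show "X \<subseteq> carrier M" using submodule_subset X by blast
      show "carrier M \<subseteq> X"
        using set_add_subset_submodule[OF X(1) SX subset_refl] X(2) by simp
    qed
  qed
  then show ?thesis using S by (simp add: small_submodule_def)
qed

text \<open>
  If \<open>S + X = B\<close> with \<open>X \<subseteq> B\<close>, adding the complement \<open>A\<close> gives \<open>S + (X + A) = M\<close>, so \<open>X + A = M\<close>, and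
  therefore \<open>X = B\<close> since \<open>A\<close> meets \<open>B\<close> only in zero. For a submodule \<open>B\<close> without a complement the
  implication can fail.
\<close>

lemma small_imp_small_in_summand:
  assumes dec: "direct_decomp R M A B" and small: "small_submodule R M S" and "S \<subseteq> B"
  shows "small_submodule R (M\<lparr>carrier := B\<rparr>) S"
proof -
  have A: "submodule A R M" and B: "submodule B R M"
    and sum: "A <+>\<^bsub>M\<^esub> B = carrier M" and int: "A \<inter> B = {\<zero>\<^bsub>M\<^esub>}"
    using dec by (auto simp: direct_decomp_def)
  have S: "submodule S R M" using small by (simp add: small_submodule_def)
  have "X = B" if X: "submodule X R M" "X \<subseteq> B" "S <+>\<^bsub>M\<^esub> X = B" for X
  proof -
    have XA: "submodule (X <+>\<^bsub>M\<^esub> A) R M" by (rule submodule_set_add(1)[OF X(1) A])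
    have "S <+>\<^bsub>M\<^esub> (X <+>\<^bsub>M\<^esub> A) = (S <+>\<^bsub>M\<^esub> X) <+>\<^bsub>M\<^esub> A"
      using M.add.set_mult_assoc[of S X A] submodule_subset S X(1) A
      by (simp add: set_add_def)
    also have "\<dots> = A <+>\<^bsub>M\<^esub> B"
    proof -
      have "x \<in> B <+>\<^bsub>M\<^esub> A \<longleftrightarrow> x \<in> A <+>\<^bsub>M\<^esub> B" for x
        unfolding mem_set_add using mem_submodule[OF A] mem_submodule[OF B] M.a_comm by metis
      then show ?thesis unfolding X(3) by blast
    qed
    finally have "X <+>\<^bsub>M\<^esub> A = carrier M"
      using small XA sum by (simp add: small_submodule_def)
    have "B \<subseteq> X"
    proof
      fix b assume b: "b \<in> B"
      then have "b \<in> X <+>\<^bsub>M\<^esub> A" using \<open>X <+>\<^bsub>M\<^esub> A = carrier M\<close> mem_submodule[OF B] by simp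
      then obtain x a where xa: "x \<in> X" "a \<in> A" "b = x \<oplus>\<^bsub>M\<^esub> a" by (auto simp: mem_set_add)
      then have "a = b \<ominus>\<^bsub>M\<^esub> x"
        using mem_submodule[OF X(1)] mem_submodule[OF A] by (simp add: add_minus_cancel)
      then have "a \<in> B" using b xa X submodule_minus[OF B] by blast
      then have "a = \<zero>\<^bsub>M\<^esub>" using xa int by blast
      then show "b \<in> X" using xa mem_submodule[OF X(1)] by simp
    qed
    then show ?thesis using X by blast
  qed
  then show ?thesis
    using S assms(3) by (simp add: small_submodule_def submodule_restrict_iff[OF B] set_add_restrict)
qed

section \<open>Submodules lying above a direct summand\<close>

lemma lies_above_summand_iff:
  "lies_above_summand R M X \<longleftrightarrow> submodule X R M \<and>
    (\<exists>A B. direct_decomp R M A B \<and> A \<subseteq> X \<and> small_submodule R M (X \<inter> B))"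
proof -
  have "small_submodule R (M\<lparr>carrier := B\<rparr>) (B \<inter> X) \<longleftrightarrow> small_submodule R M (X \<inter> B)"
    if "direct_decomp R M A B" for A B
    using small_in_submodule_imp_small[of B "B \<inter> X"] small_imp_small_in_summand[of A B "B \<inter> X"] that
    by (auto simp: direct_decomp_def Int_commute)
  then show ?thesis unfolding lies_above_summand_def by blast
qed

text \<open>
  If \<open>M = A' \<oplus> B'\<close> is a decomposition that witnesses the claim for \<open>X \<inter> B\<close>, so that \<open>A' \<subseteq> B\<close>, then
  \<open>M = (A + A') \<oplus> (B \<inter> B')\<close>. The remainder \<open>X \<inter> (B \<inter> B')\<close> is the one left over for \<open>X \<inter> B\<close>, so no
  new smallness has to be checked.
\<close>

lemma lies_above_summand_extend:
  assumes dec: "direct_decomp R M A B" and X: "submodule X R M" and "A \<subseteq> X"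
    and "lies_above_summand R M (X \<inter> B)"
  shows "lies_above_summand R M X"
proof -
  have A: "submodule A R M" and B: "submodule B R M"
    and sum: "A <+>\<^bsub>M\<^esub> B = carrier M" and int: "A \<inter> B = {\<zero>\<^bsub>M\<^esub>}"
    using dec by (auto simp: direct_decomp_def)
  obtain A' B' where dec': "direct_decomp R M A' B'" and A'X: "A' \<subseteq> X \<inter> B"
    and small: "small_submodule R M (X \<inter> B \<inter> B')"
    using assms(4) unfolding lies_above_summand_iff by blast
  have A': "submodule A' R M" and B': "submodule B' R M"
    and sum': "A' <+>\<^bsub>M\<^esub> B' = carrier M" and int': "A' \<inter> B' = {\<zero>\<^bsub>M\<^esub>}"
    using dec' by (auto simp: direct_decomp_def)
  note mem = mem_submodule[OF A] mem_submodule[OF B] mem_submodule[OF A'] mem_submodule[OF B']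
  have AA': "submodule (A <+>\<^bsub>M\<^esub> A') R M" by (rule submodule_set_add(1)[OF A A'])
  have BB': "submodule (B \<inter> B') R M" by (rule submodule_inter[OF B B'])
  have "direct_decomp R M (A <+>\<^bsub>M\<^esub> A') (B \<inter> B')"
    unfolding direct_decomp_def
  proof (intro conjI AA' BB')
    show "A <+>\<^bsub>M\<^esub> A' <+>\<^bsub>M\<^esub> (B \<inter> B') = carrier M"
    proof
      show "A <+>\<^bsub>M\<^esub> A' <+>\<^bsub>M\<^esub> (B \<inter> B') \<subseteq> carrier M"
        using submodule_subset submodule_set_add(1)[OF AA' BB'] by blast
      show "carrier M \<subseteq> A <+>\<^bsub>M\<^esub> A' <+>\<^bsub>M\<^esub> (B \<inter> B')"
      proof
        fix x assume x: "x \<in> carrier M"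
        obtain a b where ab: "a \<in> A" "b \<in> B" "x = a \<oplus>\<^bsub>M\<^esub> b"
          using x unfolding sum[symmetric] by (rule set_addE)
        obtain a' b' where ab': "a' \<in> A'" "b' \<in> B'" "b = a' \<oplus>\<^bsub>M\<^esub> b'"
          using mem(2)[OF ab(2)] unfolding sum'[symmetric] by (rule set_addE)
        have "b' = b \<ominus>\<^bsub>M\<^esub> a'" using ab' mem by (simp add: add_minus_cancel)
        then have "b' \<in> B" using ab ab' A'X submodule_minus[OF B] by blast
        moreover have "x = (a \<oplus>\<^bsub>M\<^esub> a') \<oplus>\<^bsub>M\<^esub> b'" using ab ab' mem by (simp add: M.a_assoc)
        ultimately show "x \<in> A <+>\<^bsub>M\<^esub> A' <+>\<^bsub>M\<^esub> (B \<inter> B')"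
          using ab(1) ab'(1,2) by (simp add: set_addI)
      qed
    qed
    show "(A <+>\<^bsub>M\<^esub> A') \<inter> (B \<inter> B') = {\<zero>\<^bsub>M\<^esub>}"
    proof
      show "{\<zero>\<^bsub>M\<^esub>} \<subseteq> (A <+>\<^bsub>M\<^esub> A') \<inter> (B \<inter> B')"
        using submodule_zero[OF AA'] submodule_zero[OF BB'] by simp
      show "(A <+>\<^bsub>M\<^esub> A') \<inter> (B \<inter> B') \<subseteq> {\<zero>\<^bsub>M\<^esub>}"
      proof
        fix x assume "x \<in> (A <+>\<^bsub>M\<^esub> A') \<inter> (B \<inter> B')"
        then obtain a a' where a: "a \<in> A" "a' \<in> A'" "x = a \<oplus>\<^bsub>M\<^esub> a'" and xB: "x \<in> B" "x \<in> B'"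
          by (auto simp: mem_set_add)
        have "a = x \<ominus>\<^bsub>M\<^esub> a'" using a mem by (simp add: add_minus_cancel)
        then have "a \<in> B" using a xB A'X submodule_minus[OF B] by blast
        then have "a = \<zero>\<^bsub>M\<^esub>" using a int by blast
        then have "x = a'" using a mem by simp
        then show "x \<in> {\<zero>\<^bsub>M\<^esub>}" using a(2) xB(2) int' by blast
      qed
    qed
  qed
  moreover have "A <+>\<^bsub>M\<^esub> A' \<subseteq> X"
    using set_add_subset_submodule[OF X] assms(3) A'X by simp
  moreover have "small_submodule R M (X \<inter> (B \<inter> B'))" using small by (simp add: Int_assoc)
  ultimately show ?thesis using X unfolding lies_above_summand_iff by blast
qed

lemma small_lies_above_summand:
  assumes "small_submodule R M X"
  shows "lies_above_summand R M X"
proof -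
  have X: "submodule X R M" using assms by (simp add: small_submodule_def)
  have "{\<zero>\<^bsub>M\<^esub>} <+>\<^bsub>M\<^esub> carrier M = carrier M"
    using submodule_set_add[OF submodule_zero_set submodule_carrier] submodule_subset by blast
  then have "direct_decomp R M {\<zero>\<^bsub>M\<^esub>} (carrier M)"
    using submodule_zero_set submodule_carrier by (simp add: direct_decomp_def)
  moreover have "X \<inter> carrier M = X" using submodule_subset[OF X] by blast
  ultimately show ?thesis
    using assms X submodule_zero[OF X] unfolding lies_above_summand_iff
    by (intro conjI exI[of _ "{\<zero>\<^bsub>M\<^esub>}"] exI[of _ "carrier M"]) simp_all
qed

text \<open>
  A decomposition \<open>A \<oplus> B\<close> of the image of the idempotent \<open>p\<close> extends to \<open>M\<close> by replacing \<open>B\<close> with its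
  preimage under \<open>p\<close>. Since \<open>p\<close> fixes \<open>X\<close>, this preimage meets \<open>X\<close> in \<open>X \<inter> B\<close>.
\<close>

lemma lies_above_summand_of_summand:
  assumes p: "p \<in> mod_hom R M M" and idem: "\<And>x. x \<in> p ` carrier M \<Longrightarrow> p x = x"
    and above: "lies_above_summand R (M\<lparr>carrier := p ` carrier M\<rparr>) X"
  shows "lies_above_summand R M X"
proof -
  let ?P = "p ` carrier M"
  have P: "submodule ?P R M" by (rule end_image_submodule[OF p submodule_carrier])
  obtain A B where X: "submodule X R (M\<lparr>carrier := ?P\<rparr>)"
    and dec: "direct_decomp R (M\<lparr>carrier := ?P\<rparr>) A B"
    and AX: "A \<subseteq> X" and small: "small_submodule R (M\<lparr>carrier := B\<rparr>) (B \<inter> X)"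
    using above by (auto simp: lies_above_summand_def)
  have X: "submodule X R M" "X \<subseteq> ?P" using X by (simp_all add: submodule_restrict_iff[OF P])
  have A: "submodule A R M" "A \<subseteq> ?P" and B: "submodule B R M" "B \<subseteq> ?P"
    and sum: "A <+>\<^bsub>M\<^esub> B = ?P" and int: "A \<inter> B = {\<zero>\<^bsub>M\<^esub>}"
    using dec by (simp_all add: direct_decomp_def submodule_restrict_iff[OF P] set_add_restrict)
  let ?K = "{x \<in> carrier M. p x \<in> B}"
  have K: "submodule ?K R M" by (rule end_vimage_submodule[OF p B(1)])
  note mem = mem_submodule[OF A(1)] mem_submodule[OF B(1)]
  have "direct_decomp R M A ?K"
    unfolding direct_decomp_def
  proof (intro conjI A(1) K)
    show "A <+>\<^bsub>M\<^esub> ?K = carrier M"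
    proof
      show "A <+>\<^bsub>M\<^esub> ?K \<subseteq> carrier M"
        using submodule_subset submodule_set_add(1)[OF A(1) K] by blast
      show "carrier M \<subseteq> A <+>\<^bsub>M\<^esub> ?K"
      proof
        fix x assume x: "x \<in> carrier M"
        obtain a b where ab: "a \<in> A" "b \<in> B" "p x = a \<oplus>\<^bsub>M\<^esub> b"
          using imageI[OF x, of p] unfolding sum[symmetric] by (auto elim: set_addE)
        have "p (x \<ominus>\<^bsub>M\<^esub> a) = b"
          using ab x mem end_minus[OF p, of x a] idem[of a] A(2) add_minus_cancel(3)[of b a]
          by (metis subsetD)
        then have "x \<ominus>\<^bsub>M\<^esub> a \<in> ?K" using ab x mem by simp
        moreover have "x = a \<oplus>\<^bsub>M\<^esub> (x \<ominus>\<^bsub>M\<^esub> a)" using ab x mem by (simp add: add_minus_cancel)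
        ultimately show "x \<in> A <+>\<^bsub>M\<^esub> ?K" using ab(1) unfolding mem_set_add by blast
      qed
    qed
    have "p x = x" "x \<in> carrier M" if "x \<in> A" for x
      using that A mem idem by blast+
    then have "A \<inter> ?K = A \<inter> B" by auto
    then show "A \<inter> ?K = {\<zero>\<^bsub>M\<^esub>}" using int by simp
  qed
  moreover have "X \<inter> ?K = B \<inter> X"
  proof -
    have "p x = x" "x \<in> carrier M" if "x \<in> X" for x
      using that X mem_submodule idem by blast+
    then show ?thesis by auto
  qed
  moreover have "small_submodule R M (B \<inter> X)"
    by (rule small_in_submodule_imp_small[OF B(1) small])
  ultimately show ?thesis using X AX unfolding lies_above_summand_iff by metis
qed


section \<open>Splitting images by the D2 condition\<close>

text \<open>
  The first isomorphism theorem for the quotient as it occurs in the D2 condition.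
\<close>

lemma quot_mod_kernel_iso_image:
  assumes h: "h \<in> mod_hom R M M" and K_def: "K = {x \<in> carrier M. h x = \<zero>\<^bsub>M\<^esub>}"
  shows "mod_iso R (quot_mod M K) (M\<lparr>carrier := h ` carrier M\<rparr>)"
proof -
  have K: "submodule K R M" unfolding K_def by (rule end_kernel_submodule[OF h])
  let ?coset = "\<lambda>x. K +>\<^bsub>M\<^esub> x"
  (* h is constant on each coset of its kernel *)
  define f where "f C = the_elem (h ` C)" for C
  have mem_coset: "y \<in> ?coset x \<longleftrightarrow> (\<exists>k\<in>K. y = k \<oplus>\<^bsub>M\<^esub> x)" for x y
    by (auto simp: a_r_coset_def')
  have self: "x \<in> ?coset x" if "x \<in> carrier M" for x
    using that submodule_zero[OF K] by (force simp: mem_coset)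
  have in_K: "k \<in> carrier M \<and> h k = \<zero>\<^bsub>M\<^esub>" if "k \<in> K" for k
    using that by (simp add: K_def)
  have on_coset: "y \<in> carrier M \<and> h y = h x" if "x \<in> carrier M" "y \<in> ?coset x" for x y
    using that end_add[OF h] end_closed[OF h] in_K by (auto simp: mem_coset)
  have f_eq: "f C = v" if "C \<noteq> {}" "\<And>y. y \<in> C \<Longrightarrow> h y = v" for C v
  proof -
    have "h ` C = {v}" using that by force
    then show ?thesis by (simp add: f_def)
  qed
  have f_coset: "f (?coset x) = h x" if "x \<in> carrier M" for x
    using f_eq[of "?coset x" "h x"] self[OF that] on_coset[OF that] by blast
  have carrier_quot: "carrier (quot_mod M K) = ?coset ` carrier M"
    by (auto simp: quot_mod_def A_RCOSETS_def' )
  have "f \<in> mod_hom R (quot_mod M K) (M\<lparr>carrier := h ` carrier M\<rparr>)"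
    unfolding mod_hom_def hom_def
  proof (intro CollectI conjI ballI)
    show "f \<in> carrier (add_monoid (quot_mod M K)) \<rightarrow> carrier (add_monoid (M\<lparr>carrier := h ` carrier M\<rparr>))"
      using f_coset by (auto simp: carrier_quot)
  next
    fix C D assume "C \<in> carrier (add_monoid (quot_mod M K))" "D \<in> carrier (add_monoid (quot_mod M K))"
    then obtain x y where x: "x \<in> carrier M" "C = ?coset x" and y: "y \<in> carrier M" "D = ?coset y"
      by (auto simp: carrier_quot)
    have "f (C <+>\<^bsub>M\<^esub> D) = h x \<oplus>\<^bsub>M\<^esub> h y"
    proof (rule f_eq)
      show "C <+>\<^bsub>M\<^esub> D \<noteq> {}" using set_addI[OF self[OF x(1)] self[OF y(1)]] x(2) y(2) by blast
      show "h u = h x \<oplus>\<^bsub>M\<^esub> h y" if "u \<in> C <+>\<^bsub>M\<^esub> D" for u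
      proof -
        obtain c d where "c \<in> C" "d \<in> D" "u = c \<oplus>\<^bsub>M\<^esub> d" using \<open>u \<in> C <+>\<^bsub>M\<^esub> D\<close> by (rule set_addE)
        then show ?thesis
          using on_coset[OF x(1), of c] on_coset[OF y(1), of d] x(2) y(2) end_add[OF h, of c d] by simp
      qed
    qed
    then show "f (C \<otimes>\<^bsub>add_monoid (quot_mod M K)\<^esub> D)
        = f C \<otimes>\<^bsub>add_monoid (M\<lparr>carrier := h ` carrier M\<rparr>)\<^esub> f D"
      using x y f_coset by (simp add: quot_mod_def)
  next
    fix a C assume a: "a \<in> carrier R" and "C \<in> carrier (quot_mod M K)"
    then obtain x where x: "x \<in> carrier M" "C = ?coset x"
      by (auto simp: carrier_quot)
    have "f (\<Union>y\<in>C. ?coset (a \<odot>\<^bsub>M\<^esub> y)) = a \<odot>\<^bsub>M\<^esub> h x"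
    proof (rule f_eq)
      show "(\<Union>y\<in>C. ?coset (a \<odot>\<^bsub>M\<^esub> y)) \<noteq> {}"
        using self[OF x(1)] self[OF act_closed[OF a x(1)]] x(2) by blast
      show "h u = a \<odot>\<^bsub>M\<^esub> h x" if u: "u \<in> (\<Union>y\<in>C. ?coset (a \<odot>\<^bsub>M\<^esub> y))" for u
      proof -
        obtain y where y: "y \<in> ?coset x" "u \<in> ?coset (a \<odot>\<^bsub>M\<^esub> y)" using u x(2) by blast
        then have "y \<in> carrier M" "h y = h x" using on_coset[OF x(1)] by blast+
        then show ?thesis
          using on_coset[of "a \<odot>\<^bsub>M\<^esub> y" u] y(2) a act_closed end_smult[OF h] by simp
      qed
    qed
    then show "f (a \<odot>\<^bsub>quot_mod M K\<^esub> C) = a \<odot>\<^bsub>M\<lparr>carrier := h ` carrier M\<rparr>\<^esub> f C"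
      using x f_coset by (simp add: quot_mod_def)
  qed
  moreover have "bij_betw f (carrier (quot_mod M K)) (h ` carrier M)"
    unfolding bij_betw_def
  proof
    show "f ` carrier (quot_mod M K) = h ` carrier M"
      using f_coset by (simp add: carrier_quot image_image)
    show "inj_on f (carrier (quot_mod M K))"
    proof (rule inj_onI)
      fix C D assume "C \<in> carrier (quot_mod M K)" "D \<in> carrier (quot_mod M K)" and eq: "f C = f D"
      then obtain x y where x: "x \<in> carrier M" "C = ?coset x" and y: "y \<in> carrier M" "D = ?coset y"
        by (auto simp: carrier_quot)
      have "y \<ominus>\<^bsub>M\<^esub> x \<in> K"
        using eq x y f_coset end_minus[OF h] end_closed[OF h] by (simp add: K_def minus_self)
      then have "y \<in> ?coset x"
        using x(1) y(1) unfolding mem_coset by (metis add_minus_cancel(2))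
      then show "C = D"
        using M.a_repr_independence[OF _ x(1) submodule_subgroup[OF K]] x(2) y(2) by simp
    qed
  qed
  ultimately show ?thesis unfolding mod_iso_def by auto
qed

lemma D2_kernel_direct_summand:
  assumes D2: "D2_module R M" and h: "h \<in> mod_hom R M M"
    and "direct_summand R M (h ` carrier M)"
  shows "direct_summand R M {x \<in> carrier M. h x = \<zero>\<^bsub>M\<^esub>}"
  using D2 end_kernel_submodule[OF h] quot_mod_kernel_iso_image[OF h refl] assms(3)
  unfolding D2_module_def by blast

lemma direct_decomp_idempotent:
  assumes e: "e \<in> mod_hom R M M" and idem: "\<And>x. x \<in> carrier M \<Longrightarrow> e (e x) = e x"
  shows "direct_decomp R M (e ` carrier M) {x \<in> carrier M. e x = \<zero>\<^bsub>M\<^esub>}" (is "direct_decomp R M ?A ?B")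
proof -
  have A: "submodule ?A R M" by (rule end_image_submodule[OF e submodule_carrier])
  have B: "submodule ?B R M" by (rule end_kernel_submodule[OF e])
  show ?thesis
    unfolding direct_decomp_def
  proof (intro conjI A B)
    show "?A <+>\<^bsub>M\<^esub> ?B = carrier M"
    proof
      show "?A <+>\<^bsub>M\<^esub> ?B \<subseteq> carrier M" using submodule_subset submodule_set_add(1)[OF A B] by blast
      show "carrier M \<subseteq> ?A <+>\<^bsub>M\<^esub> ?B"
      proof
        fix x assume x: "x \<in> carrier M"
        then have "x \<ominus>\<^bsub>M\<^esub> e x \<in> ?B" using end_props[OF e] idem by (simp add: minus_self)
        then have "e x \<oplus>\<^bsub>M\<^esub> (x \<ominus>\<^bsub>M\<^esub> e x) \<in> ?A <+>\<^bsub>M\<^esub> ?B" using x by (intro set_addI) auto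
        then show "x \<in> ?A <+>\<^bsub>M\<^esub> ?B" using x end_closed[OF e] by (simp add: add_minus_cancel)
      qed
    qed
    show "?A \<inter> ?B = {\<zero>\<^bsub>M\<^esub>}" using submodule_zero[OF A] submodule_zero[OF B] idem by auto
  qed
qed

text \<open>
  The kernel \<open>K\<close> of \<open>e f\<close> has a complement \<open>B\<close> by D2. The map \<open>e f\<close> is injective on \<open>B\<close> and has the
  same image on \<open>B\<close> as \<open>e\<close> has on \<open>M\<close>, so \<open>f(B)\<close> is a complement of the kernel of \<open>e\<close>. The part of
  \<open>f(M)\<close> inside this kernel is \<open>f(K)\<close>. It is important that this is again the image of an endomorphism
  of \<open>M\<close>, namely of \<open>f\<close> after the projection onto \<open>K\<close>, so that the splitting can be iterated.
\<close>

lemma D2_split_image: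
  assumes D2: "D2_module R M" and f: "f \<in> mod_hom R M M" and e: "e \<in> mod_hom R M M"
    and idem: "\<And>x. x \<in> carrier M \<Longrightarrow> e (e x) = e x"
    and image: "e ` f ` carrier M = e ` carrier M"
  obtains A g where "direct_decomp R M A {x \<in> carrier M. e x = \<zero>\<^bsub>M\<^esub>}" "A \<subseteq> f ` carrier M"
    "g \<in> mod_hom R M M" "g ` carrier M = f ` carrier M \<inter> {x \<in> carrier M. e x = \<zero>\<^bsub>M\<^esub>}"
proof -
  let ?E = "{x \<in> carrier M. e x = \<zero>\<^bsub>M\<^esub>}"
  let ?K = "{x \<in> carrier M. e (f x) = \<zero>\<^bsub>M\<^esub>}"
  have "(\<lambda>x. e (f x)) ` carrier M = e ` carrier M" using image by (simp add: image_image)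
  moreover have "direct_summand R M (e ` carrier M)"
    using direct_decomp_idempotent[OF e idem] unfolding direct_summand_def by blast
  ultimately have "direct_summand R M ?K"
    using D2_kernel_direct_summand[OF D2 end_comp[OF e f]] by simp
  then obtain B where dec: "direct_decomp R M ?K B" unfolding direct_summand_def by blast
  have K: "submodule ?K R M" and B: "submodule B R M" and sum: "?K <+>\<^bsub>M\<^esub> B = carrier M"
    and int: "?K \<inter> B = {\<zero>\<^bsub>M\<^esub>}"
    using dec unfolding direct_decomp_def by blast+
  obtain p where p: "p \<in> mod_hom R M M" and pK: "\<And>x. x \<in> carrier M \<Longrightarrow> p x \<in> ?K"
    and p_id: "\<And>x. x \<in> ?K \<Longrightarrow> p x = x" and "{x \<in> carrier M. p x = \<zero>\<^bsub>M\<^esub>} = B"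
    by (rule direct_decomp_projection[OF dec]) blast
  have fB: "submodule (f ` B) R M" by (rule end_image_submodule[OF f B])
  have E: "submodule ?E R M" by (rule end_kernel_submodule[OF e])
  have split: "\<exists>k\<in>?K. \<exists>b\<in>B. x = k \<oplus>\<^bsub>M\<^esub> b" if "x \<in> carrier M" for x
    using that eqset_imp_iff[OF sum, of x] by (simp only: mem_set_add)
  have "direct_decomp R M (f ` B) ?E"
    unfolding direct_decomp_def
  proof (intro conjI fB E)
    show "f ` B <+>\<^bsub>M\<^esub> ?E = carrier M"
    proof
      show "f ` B <+>\<^bsub>M\<^esub> ?E \<subseteq> carrier M" using submodule_subset submodule_set_add(1)[OF fB E] by blast
      show "carrier M \<subseteq> f ` B <+>\<^bsub>M\<^esub> ?E"
      proof
        fix x assume x: "x \<in> carrier M"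
        then have "e x \<in> e ` f ` carrier M" using image by blast
        then obtain y where y: "y \<in> carrier M" "e x = e (f y)" by blast
        obtain k b where kb: "k \<in> ?K" "b \<in> B" "y = k \<oplus>\<^bsub>M\<^esub> b" using split[OF y(1)] by blast
        have b: "b \<in> carrier M" using kb mem_submodule[OF B] by blast
        have "e x = e (f b)"
          using y kb b end_props[OF f] end_props[OF e] by simp
        then have "x \<ominus>\<^bsub>M\<^esub> f b \<in> ?E"
          using x b end_props[OF f] end_props[OF e] by (simp add: minus_self)
        then have "f b \<oplus>\<^bsub>M\<^esub> (x \<ominus>\<^bsub>M\<^esub> f b) \<in> f ` B <+>\<^bsub>M\<^esub> ?E" using kb(2) by (intro set_addI) auto
        then show "x \<in> f ` B <+>\<^bsub>M\<^esub> ?E" using x b end_closed[OF f] by (simp add: add_minus_cancel)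
      qed
    qed
    show "f ` B \<inter> ?E = {\<zero>\<^bsub>M\<^esub>}"
    proof
      show "{\<zero>\<^bsub>M\<^esub>} \<subseteq> f ` B \<inter> ?E" using submodule_zero[OF fB] submodule_zero[OF E] by blast
      show "f ` B \<inter> ?E \<subseteq> {\<zero>\<^bsub>M\<^esub>}"
      proof
        fix x assume "x \<in> f ` B \<inter> ?E"
        then obtain b where b: "b \<in> B" "x = f b" "e (f b) = \<zero>\<^bsub>M\<^esub>" by blast
        then have "b \<in> ?K \<inter> B" using mem_submodule[OF B] by blast
        then have "b = \<zero>\<^bsub>M\<^esub>" using int by blast
        then show "x \<in> {\<zero>\<^bsub>M\<^esub>}" using b end_zero[OF f] by simp
      qed
    qed
  qed
  moreover have "f ` B \<subseteq> f ` carrier M" using submodule_subset[OF B] by blast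
  moreover have "(\<lambda>x. f (p x)) \<in> mod_hom R M M" by (rule end_comp[OF f p])
  moreover have "(\<lambda>x. f (p x)) ` carrier M = f ` carrier M \<inter> ?E"
  proof -
    have "p ` carrier M = ?K" using pK p_id by force
    then have "(\<lambda>x. f (p x)) ` carrier M = f ` ?K" by (metis image_image)
    also have "\<dots> = f ` carrier M \<inter> ?E" using end_closed[OF f] by auto
    finally show ?thesis .
  qed
  ultimately show thesis by (rule that)
qed

section \<open>Finite direct sums\<close>

lemma finsum_in_submodule:
  assumes "finite I" and W: "submodule W R M" and "\<And>i. i \<in> I \<Longrightarrow> x i \<in> W"
  shows "(\<Oplus>\<^bsub>M\<^esub>i\<in>I. x i) \<in> W"
  using assms(1,3)
proof (induction I)
  case empty
  then show ?case using submodule_zero[OF W] by simp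
next
  case (insert i I)
  then have "x \<in> I \<rightarrow> carrier M" "x i \<in> carrier M" using mem_submodule[OF W] by auto
  then show ?case using insert submodule_add[OF W] by (simp add: M.finsum_insert)
qed

lemma finite_small_bound:
  assumes "finite I" "\<And>i. i \<in> I \<Longrightarrow> small_submodule R M (S i)"
  shows "\<exists>W. small_submodule R M W \<and> (\<forall>i\<in>I. S i \<subseteq> W)"
  using assms
proof (induction I)
  case empty
  then show ?case using small_zero by blast
next
  case (insert i I)
  then obtain W where W: "small_submodule R M W" "\<forall>i\<in>I. S i \<subseteq> W" by blast
  have "small_submodule R M (S i)" using insert.prems by simp
  from small_add[OF this W(1)] have "small_submodule R M (S i <+>\<^bsub>M\<^esub> W)" .
  moreover have "S i \<subseteq> S i <+>\<^bsub>M\<^esub> W" "W \<subseteq> S i <+>\<^bsub>M\<^esub> W"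
    using submodule_set_add(2,3)[of "S i" W] \<open>small_submodule R M (S i)\<close> W(1)
    by (simp_all add: small_submodule_def)
  ultimately show ?case using W(2) by (intro exI[of _ "S i <+>\<^bsub>M\<^esub> W"]) blast
qed

text \<open>
  The components of the inverse of the canonical bijection; they are linear because the family of
  components of an element is unique.
\<close>

lemma internal_direct_sum_projections:
  assumes "internal_direct_sum R M I N"
  obtains p where "\<And>i. i \<in> I \<Longrightarrow> p i \<in> mod_hom R M M"
    "\<And>i. i \<in> I \<Longrightarrow> p i ` carrier M = N i"
    "\<And>i x. i \<in> I \<Longrightarrow> x \<in> N i \<Longrightarrow> p i x = x"
    "\<And>x. x \<in> carrier M \<Longrightarrow> (\<Oplus>\<^bsub>M\<^esub>i\<in>I. p i x) = x"
proof -
  let ?\<sigma> = "\<lambda>x. \<Oplus>\<^bsub>M\<^esub>i\<in>I. x i"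
  have fin: "finite I" and sub: "\<And>i. i \<in> I \<Longrightarrow> submodule (N i) R M"
    and bij: "bij_betw ?\<sigma> (\<Pi>\<^sub>E i\<in>I. N i) (carrier M)"
    using assms by (auto simp: internal_direct_sum_def)
  define c where "c = inv_into (\<Pi>\<^sub>E i\<in>I. N i) ?\<sigma>"
  define p where "p i x = c x i" for i x
  have c_in: "c x \<in> (\<Pi>\<^sub>E i\<in>I. N i)" and c_sum: "?\<sigma> (c x) = x" if "x \<in> carrier M" for x
    using bij that unfolding c_def bij_betw_def
    by (metis inv_into_into, metis (mono_tags, lifting) f_inv_into_f)
  have pN: "p i x \<in> N i" if "i \<in> I" "x \<in> carrier M" for i x
    using c_in[OF that(2)] that(1) unfolding p_def by auto
  have pM: "p i x \<in> carrier M" if "i \<in> I" "x \<in> carrier M" for i x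
    using pN[OF that] mem_submodule[OF sub[OF that(1)]] by blast
  have p_sum: "(\<Oplus>\<^bsub>M\<^esub>i\<in>I. p i x) = x" if "x \<in> carrier M" for x
    using c_sum[OF that] by (simp add: p_def)
  have uniq: "p i x = y i" if y: "\<And>i. i \<in> I \<Longrightarrow> y i \<in> N i" and x: "(\<Oplus>\<^bsub>M\<^esub>i\<in>I. y i) = x" and i: "i \<in> I"
    for x y i
  proof -
    have yM: "y \<in> I \<rightarrow> carrier M" using y sub mem_submodule by blast
    have "?\<sigma> (restrict y I) = x"
      using x M.finsum_cong'[OF refl yM, of "restrict y I"] by (simp only: restrict_apply' refl)
    moreover have "restrict y I \<in> (\<Pi>\<^sub>E i\<in>I. N i)" using y by auto
    ultimately have "c x = restrict y I"
      using bij unfolding c_def bij_betw_def by (metis (mono_tags, lifting) inv_into_f_f)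
    then show ?thesis using i by (simp add: p_def)
  qed
  have p_end: "p i \<in> mod_hom R M M" if i: "i \<in> I" for i
  proof (rule endI)
    show "p i x \<in> carrier M" if "x \<in> carrier M" for x using pM[OF i that] .
    show "p i (x \<oplus>\<^bsub>M\<^esub> y) = p i x \<oplus>\<^bsub>M\<^esub> p i y" if xy: "x \<in> carrier M" "y \<in> carrier M" for x y
    proof (rule uniq[OF _ _ i])
      show "p j x \<oplus>\<^bsub>M\<^esub> p j y \<in> N j" if "j \<in> I" for j
        using submodule_add[OF sub[OF that]] pN[OF that] xy by blast
      show "(\<Oplus>\<^bsub>M\<^esub>i\<in>I. p i x \<oplus>\<^bsub>M\<^esub> p i y) = x \<oplus>\<^bsub>M\<^esub> y"
        using M.finsum_addf[of "\<lambda>i. p i x" I "\<lambda>i. p i y"] pM xy p_sum by auto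
    qed
    show "p i (a \<odot>\<^bsub>M\<^esub> x) = a \<odot>\<^bsub>M\<^esub> p i x" if a: "a \<in> carrier R" and x: "x \<in> carrier M" for a x
    proof (rule uniq[OF _ _ i])
      show "a \<odot>\<^bsub>M\<^esub> p j x \<in> N j" if "j \<in> I" for j
        using submodule_smult[OF sub[OF that]] pN[OF that] a x by blast
      have "(\<Oplus>\<^bsub>M\<^esub>j\<in>J. a \<odot>\<^bsub>M\<^esub> p j x) = a \<odot>\<^bsub>M\<^esub> (\<Oplus>\<^bsub>M\<^esub>j\<in>J. p j x)" if "J \<subseteq> I" for J
        using finite_subset[OF that fin] that
      proof (induction J)
        case empty
        then show ?case using a by (simp add: smult_zero_vector)
      next
        case (insert j J)
        then have "(\<lambda>j. p j x) \<in> J \<rightarrow> carrier M" "(\<lambda>j. a \<odot>\<^bsub>M\<^esub> p j x) \<in> J \<rightarrow> carrier M" "p j x \<in> carrier M"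
          using pM x act_closed[OF a] by auto
        then show ?case
          using insert a act_closed act_vector_distr[OF a] by (simp add: M.finsum_insert M.finsum_closed)
      qed
      then show "(\<Oplus>\<^bsub>M\<^esub>i\<in>I. a \<odot>\<^bsub>M\<^esub> p i x) = a \<odot>\<^bsub>M\<^esub> x" using p_sum[OF x] by simp
    qed
  qed
  have p_id: "p i x = x" if i: "i \<in> I" and x: "x \<in> N i" for i x
  proof -
    have "p i x = (if i = i then x else \<zero>\<^bsub>M\<^esub>)"
    proof (rule uniq[where y = "\<lambda>j. if i = j then x else \<zero>\<^bsub>M\<^esub>", OF _ _ i])
      show "(if i = j then x else \<zero>\<^bsub>M\<^esub>) \<in> N j" if "j \<in> I" for j
        using x submodule_zero[OF sub[OF that]] by auto
      show "(\<Oplus>\<^bsub>M\<^esub>j\<in>I. if i = j then x else \<zero>\<^bsub>M\<^esub>) = x"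
        using M.finsum_singleton[OF i fin, of "\<lambda>_. x"] mem_submodule[OF sub[OF i] x] by simp
    qed
    then show ?thesis by simp
  qed
  have "p i ` carrier M = N i" if i: "i \<in> I" for i
    using pN[OF i] p_id[OF i] mem_submodule[OF sub[OF i]] by force
  then show thesis using that p_end p_id p_sum by blast
qed

section \<open>Images of endomorphisms of a finite direct sum\<close>

text \<open>
  The induction is on the set \<open>J\<close> of those components \<open>i\<close> on which the image of \<open>h\<close> is not yet known
  to be small. It runs over all \<open>h\<close> at once, because each step replaces \<open>h\<close> by \<open>h - e h\<close>. The values
  have to stay inside \<open>P\<close>, as \<open>comp\<close> speaks only about maps into \<open>P\<close>.
\<close>

lemma image_lies_above_from_source_components:
  assumes "finite I" and p: "\<And>i. i \<in> I \<Longrightarrow> p i \<in> mod_hom R M M"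
    and p_sum: "\<And>x. x \<in> carrier M \<Longrightarrow> (\<Oplus>\<^bsub>M\<^esub>i\<in>I. p i x) = x"
    and P: "submodule P R M"
    and comp: "\<And>i h. i \<in> I \<Longrightarrow> h \<in> mod_hom R M M \<Longrightarrow> h ` carrier M \<subseteq> P \<Longrightarrow>
      lies_above_summand R M (h ` p i ` carrier M)"
    and h: "h \<in> mod_hom R M M" "h ` carrier M \<subseteq> P"
  shows "lies_above_summand R M (h ` carrier M)"
proof -
  have pc: "submodule (p i ` carrier M) R M" if "i \<in> I" for i
    by (rule end_image_submodule[OF p[OF that] submodule_carrier])
  have "lies_above_summand R M (h ` carrier M)"
    if "J \<subseteq> I" "h \<in> mod_hom R M M" "h ` carrier M \<subseteq> P"
      "\<And>i. i \<in> I - J \<Longrightarrow> small_submodule R M (h ` p i ` carrier M)" for J h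
    using finite_subset[OF that(1) assms(1)] that
  proof (induction J arbitrary: h)
    case empty
    obtain W where W: "small_submodule R M W" "\<forall>i\<in>I. h ` p i ` carrier M \<subseteq> W"
      using finite_small_bound[of I "\<lambda>i. h ` p i ` carrier M"] assms(1) empty.prems(4) by blast
    have "submodule W R M" using W(1) by (simp add: small_submodule_def)
    then have V: "submodule {x \<in> carrier M. h x \<in> W} R M"
      by (rule end_vimage_submodule[OF empty.prems(2)])
    have "h x \<in> W" if x: "x \<in> carrier M" for x
    proof -
      have "p i x \<in> {x \<in> carrier M. h x \<in> W}" if "i \<in> I" for i
        using W(2) that x end_closed[OF p[OF that]] by blast
      then have "(\<Oplus>\<^bsub>M\<^esub>i\<in>I. p i x) \<in> {x \<in> carrier M. h x \<in> W}"
        by (rule finsum_in_submodule[OF assms(1) V])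
      then show ?thesis using p_sum[OF x] by simp
    qed
    then have "h ` carrier M \<subseteq> W" by blast
    then show ?case
      using small_lies_above_summand small_mono[OF W(1)]
        end_image_submodule[OF empty.prems(2) submodule_carrier] by blast
  next
    case (insert j J)
    note h = insert.prems(2,3)
    have j: "j \<in> I" using insert.prems by simp
    obtain A B where dec: "direct_decomp R M A B" and A: "A \<subseteq> h ` p j ` carrier M"
      and small: "small_submodule R M (h ` p j ` carrier M \<inter> B)"
      using comp[OF j h] unfolding lies_above_summand_iff by blast
    obtain e where e: "e \<in> mod_hom R M M" and eA: "\<And>x. x \<in> carrier M \<Longrightarrow> e x \<in> A"
      and e_id: "\<And>x. x \<in> A \<Longrightarrow> e x = x" and B: "{x \<in> carrier M. e x = \<zero>\<^bsub>M\<^esub>} = B"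
      by (rule direct_decomp_projection[OF dec]) blast
    have hM: "submodule (h ` carrier M) R M" by (rule end_image_submodule[OF h(1) submodule_carrier])
    have hj: "submodule (h ` p j ` carrier M) R M" by (rule end_image_submodule[OF h(1) pc[OF j]])
    have hj_hM: "h ` p j ` carrier M \<subseteq> h ` carrier M" using end_closed[OF p[OF j]] by blast
    (* the part of h in B; because A \<subseteq> h(p j M), subtracting e h does not leave h(M), P or h(p j M) *)
    let ?g = "\<lambda>x. h x \<ominus>\<^bsub>M\<^esub> e (h x)"
    have g: "?g \<in> mod_hom R M M" by (rule end_comp[OF end_complement[OF e] h(1)])
    have gB: "?g x \<in> B" if "x \<in> carrier M" for x
      unfolding B[symmetric]
      using that end_props[OF e] end_closed[OF h(1)] e_id eA by (simp add: minus_self)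
    have g_in: "?g x \<in> H" if "submodule H R M" "h ` p j ` carrier M \<subseteq> H" "h x \<in> H" "x \<in> carrier M" for H x
    proof -
      have "e (h x) \<in> H" using that(2) A eA[OF end_closed[OF h(1) that(4)]] by blast
      then show ?thesis using submodule_minus[OF that(1,3)] by simp
    qed
    have g_image: "?g ` carrier M = h ` carrier M \<inter> B"
    proof
      show "?g ` carrier M \<subseteq> h ` carrier M \<inter> B"
        using gB g_in[OF hM hj_hM] by blast
      show "h ` carrier M \<inter> B \<subseteq> ?g ` carrier M"
      proof
        fix y assume "y \<in> h ` carrier M \<inter> B"
        then obtain x where x: "x \<in> carrier M" "y = h x" "e (h x) = \<zero>\<^bsub>M\<^esub>" using B by blast
        then have "?g x = y" using end_closed[OF h(1)] by (simp add: minus_zero)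
        then show "y \<in> ?g ` carrier M" using x(1) by blast
      qed
    qed
    have "lies_above_summand R M (?g ` carrier M)"
    proof (rule insert.IH)
      show "J \<subseteq> I" using insert.prems by simp
      show "?g \<in> mod_hom R M M" by (rule g)
      show "?g ` carrier M \<subseteq> P" unfolding g_image using h(2) by blast
      show "small_submodule R M (?g ` p i ` carrier M)" if i: "i \<in> I - J" for i
      proof (cases "i = j")
        case True
        have "?g ` p j ` carrier M \<subseteq> h ` p j ` carrier M \<inter> B"
          using gB g_in[OF hj subset_refl] end_closed[OF p[OF j]] by blast
        then show ?thesis
          using small_mono[OF small] end_image_submodule[OF g pc[OF j]] True by simp
      next
        case False
        then have "small_submodule R M (h ` p i ` carrier M)" using insert.prems(4) i by simp
        from small_image[OF this end_complement[OF e]] show ?thesis by (simp add: image_image)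
      qed
    qed
    then show ?case
      unfolding g_image using lies_above_summand_extend[OF dec hM] A hj_hM by blast
  qed
  from this[OF subset_refl h] show ?thesis by simp
qed

text \<open>
  The induction is on the set \<open>J\<close> of those indices \<open>i\<close> for which the component \<open>p\<^sub>i f(M)\<close> is not yet
  known to be small. Each step replaces \<open>f\<close> by the endomorphism from \<open>D2_split_image\<close>.
\<close>

lemma image_lies_above_from_target_components:
  assumes "finite I" and p: "\<And>i. i \<in> I \<Longrightarrow> p i \<in> mod_hom R M M"
    and p_idem: "\<And>i x. i \<in> I \<Longrightarrow> x \<in> p i ` carrier M \<Longrightarrow> p i x = x"
    and p_sum: "\<And>x. x \<in> carrier M \<Longrightarrow> (\<Oplus>\<^bsub>M\<^esub>i\<in>I. p i x) = x"
    and D2: "D2_module R M"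
    and comp: "\<And>i h. i \<in> I \<Longrightarrow> h \<in> mod_hom R M M \<Longrightarrow> lies_above_summand R M (p i ` h ` carrier M)"
    and f: "f \<in> mod_hom R M M"
  shows "lies_above_summand R M (f ` carrier M)"
proof -
  have "lies_above_summand R M (f ` carrier M)"
    if "J \<subseteq> I" "f \<in> mod_hom R M M"
      "\<And>i. i \<in> I - J \<Longrightarrow> small_submodule R M (p i ` f ` carrier M)" for J f
    using finite_subset[OF that(1) assms(1)] that
  proof (induction J arbitrary: f)
    case empty
    obtain W where W: "small_submodule R M W" "\<forall>i\<in>I. p i ` f ` carrier M \<subseteq> W"
      using finite_small_bound[of I "\<lambda>i. p i ` f ` carrier M"] assms(1) empty.prems(3) by blast
    have Wsub: "submodule W R M" using W(1) by (simp add: small_submodule_def)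
    have "f x \<in> W" if x: "x \<in> carrier M" for x
    proof -
      have "(\<Oplus>\<^bsub>M\<^esub>i\<in>I. p i (f x)) \<in> W"
        by (rule finsum_in_submodule[OF assms(1) Wsub]) (use W(2) x in blast)
      then show ?thesis using p_sum[OF end_closed[OF empty.prems(2) x]] by simp
    qed
    then have "f ` carrier M \<subseteq> W" by blast
    then show ?case
      using small_lies_above_summand small_mono[OF W(1)]
        end_image_submodule[OF empty.prems(2) submodule_carrier] by blast
  next
    case (insert j J)
    note f = insert.prems(2)
    have j: "j \<in> I" using insert.prems by simp
    note pj = p[OF j]
    obtain A B where dec: "direct_decomp R M A B" and A: "A \<subseteq> p j ` f ` carrier M"
      and small: "small_submodule R M (p j ` f ` carrier M \<inter> B)"
      using comp[OF j f] unfolding lies_above_summand_iff by blast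
    obtain e where e: "e \<in> mod_hom R M M" and eA: "\<And>x. x \<in> carrier M \<Longrightarrow> e x \<in> A"
      and e_id: "\<And>x. x \<in> A \<Longrightarrow> e x = x" and B: "{x \<in> carrier M. e x = \<zero>\<^bsub>M\<^esub>} = B"
      by (rule direct_decomp_projection[OF dec]) blast
    have fM: "submodule (f ` carrier M) R M" by (rule end_image_submodule[OF f submodule_carrier])
    have AM: "A \<subseteq> carrier M" using dec submodule_subset by (simp add: direct_decomp_def)
    have p_A: "p j x = x" if "x \<in> A" for x
    proof -
      have "x \<in> p j ` carrier M" using that A end_closed[OF f] by blast
      then show ?thesis by (rule p_idem[OF j])
    qed
    (* e itself need not vanish on what p j kills; precomposing with p j makes the kernel see only the
       j-th component, and it stays idempotent since p j fixes A *)
    let ?q = "\<lambda>x. e (p j x)"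
    let ?E = "{x \<in> carrier M. ?q x = \<zero>\<^bsub>M\<^esub>}"
    have q: "?q \<in> mod_hom R M M" by (rule end_comp[OF e pj])
    have q_idem: "?q (?q x) = ?q x" if "x \<in> carrier M" for x
      using eA[OF end_closed[OF pj that]] p_A e_id by simp
    have q_image: "?q ` f ` carrier M = ?q ` carrier M"
    proof
      show "?q ` f ` carrier M \<subseteq> ?q ` carrier M" using end_closed[OF f] by blast
      show "?q ` carrier M \<subseteq> ?q ` f ` carrier M"
      proof
        fix y assume "y \<in> ?q ` carrier M"
        then have y: "y \<in> A" using eA end_closed[OF pj] by blast
        then obtain x where "x \<in> carrier M" "y = p j (f x)" using A by blast
        then have "y = ?q (f x)" using e_id[OF y] by simp
        then show "y \<in> ?q ` f ` carrier M" using \<open>x \<in> carrier M\<close> by blast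
      qed
    qed
    obtain D g where dec': "direct_decomp R M D ?E" and D: "D \<subseteq> f ` carrier M"
      and g: "g \<in> mod_hom R M M" and g_image: "g ` carrier M = f ` carrier M \<inter> ?E"
      by (rule D2_split_image[OF D2 f q q_idem q_image]) blast
    have "lies_above_summand R M (g ` carrier M)"
    proof (rule insert.IH)
      show "J \<subseteq> I" using insert.prems by simp
      show "g \<in> mod_hom R M M" by (rule g)
      show "small_submodule R M (p i ` g ` carrier M)" if i: "i \<in> I - J" for i
      proof -
        have sub: "submodule (p i ` g ` carrier M) R M"
          using end_image_submodule p i g submodule_carrier by blast
        show ?thesis
        proof (cases "i = j")
          case True
          have "p j ` g ` carrier M \<subseteq> p j ` f ` carrier M \<inter> B"
            unfolding g_image B[symmetric] using end_closed[OF pj] by blast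
          then show ?thesis using small_mono[OF small] sub True by simp
        next
          case False
          then have "small_submodule R M (p i ` f ` carrier M)" using insert.prems(3) i by simp
          moreover have "p i ` g ` carrier M \<subseteq> p i ` f ` carrier M" unfolding g_image by blast
          ultimately show ?thesis using small_mono sub by blast
        qed
      qed
    qed
    then show ?case
      unfolding g_image using lies_above_summand_extend[OF dec' fM D] by blast
  qed
  from this[OF subset_refl f] show ?thesis by simp
qed

end

theorem theorem3p10:
  fixes R :: "('a, 'r) ring_scheme"
    and M :: "('a, 'b, 'm) module_scheme"
    and N :: "nat \<Rightarrow> 'b set"
    and n :: nat
  assumes "ring R" and "\<one>\<^bsub>R\<^esub> \<noteq> \<zero>\<^bsub>R\<^esub>"
    and "right_module R M"
    and "n \<ge> 1"
    and "internal_direct_sum R M {1..n} N"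
    and "D2_module R M"
    and "\<forall>i\<in>{1..n}. \<forall>j\<in>{1..n}.
           rel_d_CS_Rickart R (M\<lparr>carrier := N i\<rparr>) (M\<lparr>carrier := N j\<rparr>)"
  shows "d_CS_Rickart R M"
proof -
  interpret right_module R M by fact
  let ?I = "{1..n}"
  obtain p where p: "\<And>i. i \<in> ?I \<Longrightarrow> p i \<in> mod_hom R M M"
    and p_image: "\<And>i. i \<in> ?I \<Longrightarrow> p i ` carrier M = N i"
    and p_id: "\<And>i x. i \<in> ?I \<Longrightarrow> x \<in> N i \<Longrightarrow> p i x = x"
    and p_sum: "\<And>x. x \<in> carrier M \<Longrightarrow> (\<Oplus>\<^bsub>M\<^esub>i\<in>?I. p i x) = x"
    by (rule internal_direct_sum_projections[OF assms(5)]) blast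
  have N: "submodule (N i) R M" if "i \<in> ?I" for i
    using assms(5) that by (simp add: internal_direct_sum_def)
  (* an endomorphism with values in N j restricts to a map from N i to N j, and its image there lies
     above a summand of N j, which is a summand of M *)
  have block: "lies_above_summand R M (h ` p i ` carrier M)"
    if i: "i \<in> ?I" and j: "j \<in> ?I" and h: "h \<in> mod_hom R M M" and hN: "h ` carrier M \<subseteq> N j" for i j h
  proof (rule lies_above_summand_of_summand[OF p[OF j]])
    show "p j x = x" if "x \<in> p j ` carrier M" for x
      using that p_id[OF j] p_image[OF j] by simp
    have "h \<in> mod_hom R (M\<lparr>carrier := N i\<rparr>) (M\<lparr>carrier := N j\<rparr>)"
      using end_props[OF h] mem_submodule[OF N[OF i]] hN by (auto simp: mod_hom_def hom_def)
    then have "lies_above_summand R (M\<lparr>carrier := N j\<rparr>) (h ` carrier (M\<lparr>carrier := N i\<rparr>))"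
      using assms(7) i j unfolding rel_d_CS_Rickart_def by blast
    then show "lies_above_summand R (M\<lparr>carrier := p j ` carrier M\<rparr>) (h ` p i ` carrier M)"
      by (simp add: p_image[OF i] p_image[OF j])
  qed
  have row: "lies_above_summand R M (p j ` h ` carrier M)"
    if j: "j \<in> ?I" and h: "h \<in> mod_hom R M M" for j h
  proof -
    have "lies_above_summand R M ((\<lambda>x. p j (h x)) ` carrier M)"
    proof (rule image_lies_above_from_source_components[where I = ?I and p = p and P = "N j"])
      show "(\<lambda>x. p j (h x)) ` carrier M \<subseteq> N j" using end_closed[OF h] p_image[OF j] by blast
    qed (use p p_sum N[OF j] block[OF _ j] end_comp[OF p[OF j] h] in auto)
    then show ?thesis by (simp add: image_image)
  qed
  have "lies_above_summand R M (f ` carrier M)" if f: "f \<in> mod_hom R M M" for f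
  proof (rule image_lies_above_from_target_components[where I = ?I and p = p])
    show "p i x = x" if "i \<in> ?I" "x \<in> p i ` carrier M" for i x
      using that p_id p_image by blast
  qed (use p p_sum assms(6) row f in auto)
  then show ?thesis unfolding d_CS_Rickart_def by blast
qed

end
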